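(* If $M,N\in\mathcal E_3$ and $\chi(M)\ge\dim(N)+4$, then $M$ contains $N$ as an induced restriction.
   Context: A simple binary matroid (here just "matroid") is a pair $M=(E,G)$, where $G$ is identified with $\mathbb F_2^n\setminus\{0\}$ and $E\subseteq G$; $\dim(M)=n$. A flat of $G$ is a set $V\setminus\{0\}$ with $V$ a subspace, of dimension $\dim V$. $M$ contains $N=(E',G')$ as an induced restriction if there is an injective linear map $\varphi:G'\to G$ (linear on the underlying vector spaces) with $\varphi(E')=E\cap\varphi(G')$. The critical number $\chi(M)$ is the smallest $k\ge0$ such that $G\setminus E$ contains a flat of dimension $n-k$. $\mathcal E_3$ is the class of matroids $(E,G)$ with $|E\cap F|$ even for every flat $F$ of dimension at least $3$. *)

theory Defs
  imports Complex_Main "HOL-Library.Z2" "HOL-Library.Function_Algebras"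
begin

text \<open>
  Coordinate vectors over the field of two elements are functions from \<^typ>\<open>nat\<close> to \<^typ>\<open>bit\<close>
  with pointwise addition. The space of \<open>n\<close>-tuples is the set of those functions that vanish
  from index \<open>n\<close> on, so that \<open>n\<close> may be any natural number, including 0.
\<close>

definition F2_scale :: "bit \<Rightarrow> (nat \<Rightarrow> bit) \<Rightarrow> (nat \<Rightarrow> bit)" where
  "F2_scale c v = (\<lambda>i. c * v i)"

interpretation F2: vector_space F2_scale
  by unfold_locales (simp_all only: F2_scale_def fun_eq_iff plus_fun_apply distrib_left
      distrib_right mult.assoc mult_1_left simp_thms)

definition F2_space :: "nat \<Rightarrow> (nat \<Rightarrow> bit) set" where
  "F2_space n = {v. \<forall>i\<ge>n. v i = 0}"

definition geometry :: "nat \<Rightarrow> (nat \<Rightarrow> bit) set" where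
  "geometry n = F2_space n - {0}"

text \<open>
  A pair \<open>(E, G)\<close> is stored as the set \<open>E\<close> together with the number \<open>n\<close> for which
  \<open>G\<close> is \<open>geometry n\<close>.
\<close>

record matroid =
  elements :: "(nat \<Rightarrow> bit) set"
  mdim :: nat

definition ground :: "matroid \<Rightarrow> (nat \<Rightarrow> bit) set" where
  "ground M = geometry (mdim M)"

definition simple_binary_matroid :: "matroid \<Rightarrow> bool" where
  "simple_binary_matroid M \<longleftrightarrow> elements M \<subseteq> ground M"

text \<open>\<open>is_flat n d F\<close>: the set \<open>F\<close> is a flat of dimension \<open>d\<close> of \<open>geometry n\<close>.\<close>

definition is_flat :: "nat \<Rightarrow> nat \<Rightarrow> (nat \<Rightarrow> bit) set \<Rightarrow> bool" where
  "is_flat n d F \<longleftrightarrow>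
     (\<exists>V. F2.subspace V \<and> V \<subseteq> F2_space n \<and> F2.dim V = d \<and> F = V - {0})"

text \<open>
  Linearity is required on the space underlying the smaller geometry only; the values of
  the map elsewhere are irrelevant.
\<close>

definition F2_linear_on :: "nat \<Rightarrow> ((nat \<Rightarrow> bit) \<Rightarrow> (nat \<Rightarrow> bit)) \<Rightarrow> bool" where
  "F2_linear_on m \<phi> \<longleftrightarrow>
     (\<forall>u\<in>F2_space m. \<forall>v\<in>F2_space m. \<phi> (u + v) = \<phi> u + \<phi> v) \<and>
     (\<forall>c. \<forall>v\<in>F2_space m. \<phi> (F2_scale c v) = F2_scale c (\<phi> v))"

definition contains_induced_restriction :: "matroid \<Rightarrow> matroid \<Rightarrow> bool" where
  "contains_induced_restriction M N \<longleftrightarrow>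
     (\<exists>\<phi>. F2_linear_on (mdim N) \<phi> \<and>
          \<phi> ` F2_space (mdim N) \<subseteq> F2_space (mdim M) \<and>
          inj_on \<phi> (F2_space (mdim N)) \<and>
          \<phi> ` elements N = elements M \<inter> \<phi> ` ground N)"

text \<open>The dimension condition is additive to avoid truncated subtraction.\<close>

definition critical_number :: "matroid \<Rightarrow> nat" where
  "critical_number M =
     (LEAST k. \<exists>d F. d + k = mdim M \<and> is_flat (mdim M) d F \<and> F \<subseteq> ground M - elements M)"

definition E3 :: "matroid set" where
  "E3 = {M. simple_binary_matroid M \<and>
            (\<forall>d F. d \<ge> 3 \<longrightarrow> is_flat (mdim M) d F \<longrightarrow> even (card (elements M \<inter> F)))}"

lemma zero_flat: "is_flat n 0 {}"
proof -
  have "F2.dim {0 :: nat \<Rightarrow> bit} = 0"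
    using F2.dim_span[of "{}"] F2.dim_eq_card_independent[of "{}"]
    by (simp add: F2.independent_empty F2.span_empty)
  then show ?thesis
    unfolding is_flat_def F2_space_def
    by (intro exI[of _ "{0}"]) (auto simp: F2.subspace_single_0)
qed

text \<open>The minimum in the definition of the critical number is over a nonempty set.\<close>

lemma critical_number_attained:
  "\<exists>d F. d + critical_number M = mdim M \<and> is_flat (mdim M) d F \<and> F \<subseteq> ground M - elements M"
  unfolding critical_number_def
  by (rule LeastI[of _ "mdim M"]) (use zero_flat in force)

text \<open>The ambient space of functions is infinite-dimensional, but \<open>F2_space n\<close> has dimension \<open>n\<close>.\<close>

lemma dim_F2_space: "F2.dim (F2_space n) = n"
proof -
  define e :: "nat \<Rightarrow> nat \<Rightarrow> bit" where "e = (\<lambda>j i. if i = j then 1 else 0)"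
  have inj: "inj e"
    by (rule injI) (metis e_def one_neq_zero)
  have sum_e: "(\<Sum>j\<in>A. F2_scale (c j) (e j)) k = (if k \<in> A then c k else 0)"
    if "finite A" for A c k
  proof -
    have "(\<Sum>j\<in>A. F2_scale (c j) (e j)) k = (\<Sum>j\<in>A. c j * e j k)"
      using that
      by (induction A rule: finite_induct) (simp_all only: sum.empty zero_fun_apply sum.insert
          plus_fun_apply F2_scale_def simp_thms)
    also have "\<dots> = (\<Sum>j\<in>A. if k = j then c j else 0)"
      by (intro sum.cong) (auto simp: e_def)
    finally show ?thesis using that by (simp add: sum.delta')
  qed
  have sub: "e ` {..<n} \<subseteq> F2_space n"
    by (auto simp: e_def F2_space_def)
  have span: "F2_space n \<subseteq> F2.span (e ` {..<n})"
  proof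
    fix v assume v: "v \<in> F2_space n"
    have "v = (\<Sum>j<n. F2_scale (v j) (e j))"
    proof
      fix k show "v k = (\<Sum>j<n. F2_scale (v j) (e j)) k"
        using v by (subst sum_e) (auto simp: F2_space_def)
    qed
    also have "\<dots> \<in> F2.span (e ` {..<n})"
      by (intro F2.span_sum F2.span_scale F2.span_base) auto
    finally show "v \<in> F2.span (e ` {..<n})" .
  qed
  have indep: "F2.independent (e ` {..<n})"
  proof (rule F2.independent_if_scalars_zero)
    fix f x assume s: "(\<Sum>x\<in>e ` {..<n}. F2_scale (f x) x) = 0" and x: "x \<in> e ` {..<n}"
    from x obtain k where k: "k < n" "x = e k" by auto
    have "(\<Sum>j<n. F2_scale (f (e j)) (e j)) = 0"
      using s by (subst (asm) sum.reindex) (auto intro: inj_on_subset[OF inj])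
    then have "(\<Sum>j<n. F2_scale (f (e j)) (e j)) k = 0" by simp
    then show "f x = 0" using k by (subst (asm) sum_e) auto
  qed simp
  show ?thesis
    using F2.basis_card_eq_dim[OF sub span indep] card_image[OF inj_on_subset[OF inj]] by simp
qed

end

(* Membership in E3 says that the indicator function of the elements is a quadratic form q with
   q 0 = 0: on three independent vectors the vanishing third difference is the parity of a plane.
   Let U be a maximal totally singular subspace of the space of M. Its orthogonal complement
   exceeds U by at most 2 dimensions, and U has codimension at least the critical number, so
   there are u_i in U and p_i, for i < dim N, with polar (u_i, p_j) = delta_ij. Adding
   combinations of the u_i to the p_i changes the values q (p_i) and polar (p_i, p_j) at will,
   and makes e_i |-> p_i an isometric embedding of the form of N. *)

theory Submission
  imports Defs
begin

section \<open>Polar forms and arithmetic over the field of two elements\<close>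

definition polar :: "((nat \<Rightarrow> bit) \<Rightarrow> bit) \<Rightarrow> (nat \<Rightarrow> bit) \<Rightarrow> (nat \<Rightarrow> bit) \<Rightarrow> bit" where
  "polar q x y = q (x + y) + q x + q y"

text \<open>These default rules turn sums and products of bits into bit operations, out of reach of
  the ring simplification rules.\<close>

declare add_bit_eq_xor [simp del] mult_bit_eq_and [simp del]

lemma bit_double [simp]: "(a :: bit) + a = 0" "(a :: bit) + (a + b) = b"
  by (cases a; simp)+

lemma F2_add_self [simp]: "(v :: nat \<Rightarrow> bit) + v = 0"
  by (rule ext) simp

lemma F2_add_self_left [simp]: "(v :: nat \<Rightarrow> bit) + (v + w) = w"
  by (simp flip: add.assoc)

lemma F2_minus_eq_plus: "(v :: nat \<Rightarrow> bit) - w = v + w"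
  by (metis F2_add_self_left add.commute add_diff_cancel_left')

lemma F2_add_eq_iff: "(u :: nat \<Rightarrow> bit) + v = w \<longleftrightarrow> u = v + w"
  by (metis F2_add_self_left add.commute)

lemma F2_scale_apply: "F2_scale c v i = c * v i"
  by (simp add: F2_scale_def)

lemma F2_scale_simps [simp]: "F2_scale 0 v = 0" "F2_scale 1 v = v"
  by (simp_all add: F2_scale_def fun_eq_iff)

lemma sum_mult_of_bool:
  fixes c :: "nat \<Rightarrow> bit"
  assumes "i < k"
  shows "(\<Sum>j<k. c j * of_bool (i = j)) = c i" "(\<Sum>j<k. c j * of_bool (j = i)) = c i"
  using assms by (simp_all add: of_bool_def if_distrib cong: if_cong)

section \<open>Quadratic forms and their polar forms\<close>

text \<open>The polar form is symmetric and the only scalars are 0 and 1, so additivity in one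
  argument already gives bilinearity, and homogeneity reduces to \<open>q 0 = 0\<close>.\<close>

locale quadratic_form =
  fixes q :: "(nat \<Rightarrow> bit) \<Rightarrow> bit"
  assumes zero [simp]: "q 0 = 0"
    and polar_add_left: "polar q (x + y) z = polar q x z + polar q y z"
begin

abbreviation B where "B \<equiv> polar q"

lemma polar_commute: "B x y = B y x"
  by (simp add: polar_def ac_simps)

lemma polar_add_right: "B z (x + y) = B z x + B z y"
  by (metis polar_commute polar_add_left)

lemma polar_zero_left [simp]: "B 0 x = 0"
  by (simp add: polar_def)

lemma polar_zero_right [simp]: "B x 0 = 0"
  by (simp add: polar_def)

lemma add: "q (x + y) = q x + q y + B x y"
  by (simp add: polar_def ac_simps)

lemma polar_scale_left: "B (F2_scale c x) y = c * B x y"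
  by (cases c) auto

lemma polar_sum_left: "B (\<Sum>i\<in>A. F2_scale (c i) (f i)) y = (\<Sum>i\<in>A. c i * B (f i) y)"
  by (induction A rule: infinite_finite_induct)
    (simp_all only: sum.infinite sum.empty sum.insert polar_add_left polar_scale_left
      polar_zero_left simp_thms)

lemma polar_sum_right: "B y (\<Sum>i\<in>A. F2_scale (c i) (f i)) = (\<Sum>i\<in>A. c i * B y (f i))"
  by (simp add: polar_commute[of y] polar_sum_left)

section \<open>Totally singular subspaces\<close>

definition totally_singular :: "(nat \<Rightarrow> bit) set \<Rightarrow> bool" where
  "totally_singular U \<longleftrightarrow> F2.subspace U \<and> (\<forall>u\<in>U. q u = 0)"

lemma totally_singular_polar:
  assumes "totally_singular U" "u \<in> U" "v \<in> U"
  shows "B u v = 0"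
  using assms by (auto simp: totally_singular_def polar_def F2.subspace_add)

text \<open>A vector of the span is \<open>u + k c\<close> with \<open>u\<close> in
  \<open>U\<close>, and all three terms of the expansion of \<open>q\<close> at this sum
  vanish.\<close>

lemma totally_singular_insert:
  assumes U: "totally_singular U" and c: "q c = 0" "\<And>u. u \<in> U \<Longrightarrow> B u c = 0"
  shows "totally_singular (F2.span (insert c U))"
  unfolding totally_singular_def
proof (intro conjI ballI)
  fix x assume "x \<in> F2.span (insert c U)"
  then obtain k where k: "x - F2_scale k c \<in> U"
    using U by (auto simp only: F2.span_insert totally_singular_def F2.span_eq_iff[THEN iffD2]
        mem_Collect_eq)
  have "q ((x - F2_scale k c) + F2_scale k c) = 0"
    unfolding add using k U c by (cases k) (auto simp: totally_singular_def)
  then show "q x = 0" by simp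
qed (rule F2.subspace_span)

definition maximal_totally_singular :: "(nat \<Rightarrow> bit) set \<Rightarrow> (nat \<Rightarrow> bit) set \<Rightarrow> bool" where
  "maximal_totally_singular V U \<longleftrightarrow> totally_singular U \<and> U \<subseteq> V \<and>
     (\<forall>W. totally_singular W \<and> U \<subseteq> W \<and> W \<subseteq> V \<longrightarrow> W = U)"

lemma maximal_totally_singular_exists:
  assumes "F2.subspace V" "finite V"
  obtains U where "maximal_totally_singular V U"
proof -
  let ?A = "{U. totally_singular U \<and> U \<subseteq> V}"
  have "finite ?A" using assms(2) by simp
  moreover have "{0} \<in> ?A"
    using assms(1) by (auto simp: totally_singular_def F2.subspace_single_0 F2.subspace_0)
  then have "?A \<noteq> {}" by blast
  ultimately have "\<exists>U\<in>?A. \<forall>W\<in>?A. U \<subseteq> W \<longrightarrow> U = W"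
    by (rule finite_has_maximal)
  then obtain U where "U \<in> ?A" "\<forall>W\<in>?A. U \<subseteq> W \<longrightarrow> U = W" by (rule bexE)
  then have "maximal_totally_singular V U"
    by (auto simp: maximal_totally_singular_def)
  then show ?thesis by (rule that)
qed

text \<open>A maximal totally singular subspace \<open>U\<close> of \<open>V\<close> turns the quotient of its orthogonal
  complement by \<open>U\<close> into an anisotropic space, which over the field of two elements has
  dimension at most 2.\<close>

lemma orthogonal_of_maximal:
  assumes V: "F2.subspace V" and max: "maximal_totally_singular V U"
  obtains a b where "{c \<in> V. \<forall>u\<in>U. B u c = 0} \<subseteq> F2.span (U \<union> {a, b})"
proof -
  have U: "totally_singular U" "U \<subseteq> V"
    using max by (simp_all add: maximal_totally_singular_def)
  define P where "P = {c \<in> V. \<forall>u\<in>U. B u c = 0}"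
  \<comment> \<open>A singular vector orthogonal to \<open>U\<close> can be adjoined to
    \<open>U\<close>, so by maximality it already lies there.\<close>
  have sing: "c \<in> U" if "c \<in> P" "q c = 0" for c
  proof -
    have "totally_singular (F2.span (insert c U))"
      using that U by (intro totally_singular_insert) (auto simp: P_def)
    moreover have "U \<subseteq> F2.span (insert c U)"
      by (auto intro: F2.span_base)
    moreover have "F2.span (insert c U) \<subseteq> V"
      using that U V by (intro F2.span_minimal) (auto simp: P_def)
    ultimately have "F2.span (insert c U) = U"
      using max by (simp add: maximal_totally_singular_def)
    then show ?thesis using F2.span_base[of c "insert c U"] by auto
  qed
  have P_add: "c + d \<in> P" if "c \<in> P" "d \<in> P" for c d
    using that V by (auto simp: P_def polar_add_right F2.subspace_add)
  show thesis
  proof (cases "P \<subseteq> U")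
    case True
    then show ?thesis using that[of 0 0] F2.span_superset[of "U \<union> {0, 0}"] unfolding P_def by blast
  next
    case False
    then obtain a where a: "a \<in> P" "q a = 1" using sing bit_not_zero_iff by blast
    \<comment> \<open>If \<open>a\<close> is orthogonal to all of \<open>P\<close>, any member of
      \<open>P\<close> serves as \<open>b\<close>.\<close>
    obtain b where b: "b \<in> P" "B a b = 1 \<or> (\<forall>c\<in>P. B a c = 0)"
    proof (cases "\<exists>b\<in>P. B a b = 1")
      case True
      then show ?thesis using that by blast
    next
      case False
      then have "\<forall>c\<in>P. B a c = 0" using bit_not_one_iff by blast
      then show ?thesis using that a(1) by blast
    qed
    \<comment> \<open>If \<open>q c = 1\<close>, then \<open>q (a + c) = 1 + 1 + 0 = 0\<close>, so
      \<open>c\<close> is congruent to \<open>a\<close> modulo \<open>U\<close>.\<close>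
    have orth: "c \<in> F2.span (U \<union> {a, b})" if c: "c \<in> P" "B a c = 0" for c
    proof (cases "q c = 0")
      case True
      then show ?thesis using sing[OF c(1)] by (auto intro: F2.span_base)
    next
      case False
      then have "q (a + c) = 0" using a c by (simp add: add)
      then have "a + c \<in> U" by (intro sing P_add a(1) c(1))
      then have "a + (a + c) \<in> F2.span (U \<union> {a, b})"
        by (intro F2.span_add[OF F2.span_base F2.span_base]) simp_all
      then show ?thesis by simp
    qed
    have "c \<in> F2.span (U \<union> {a, b})" if c: "c \<in> P" for c
    proof (cases "B a c = 0")
      case True
      then show ?thesis using orth c by blast
    next
      case False
      \<comment> \<open>Here \<open>c\<close> itself witnesses that \<open>B a\<close> does not
        vanish on \<open>P\<close>, so \<open>B a b = 1\<close>, and adding \<open>b\<close> makes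
        \<open>c\<close> orthogonal to \<open>a\<close>.\<close>
      then have "B a (b + c) = 0" using b c by (auto simp: polar_add_right)
      then have "b + c \<in> F2.span (U \<union> {a, b})" by (intro orth P_add b(1) c)
      then have "b + (b + c) \<in> F2.span (U \<union> {a, b})"
        by (rule F2.span_add[OF F2.span_base, rotated]) simp
      then show ?thesis by simp
    qed
    then show ?thesis using that[of a b] unfolding P_def by blast
  qed
qed

section \<open>Dual systems with prescribed values\<close>

text \<open>Otherwise every \<open>x\<close> in \<open>U\<close> orthogonal to all
  \<open>p i\<close> is orthogonal to \<open>V\<close>. Each \<open>v\<close> in \<open>V\<close>
  can then be corrected by a combination of the \<open>p i\<close> to be orthogonal to
  \<open>U\<close>, so \<open>V\<close> is spanned by \<open>U\<close>, two further vectors and the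
  \<open>p i\<close>, which contradicts the dimension bound.\<close>

lemma dual_pair_extension:
  fixes u p :: "nat \<Rightarrow> nat \<Rightarrow> bit"
  assumes V: "F2.subspace V" "finite V" and max: "maximal_totally_singular V U"
    and dim: "F2.dim U + k + 2 < F2.dim V"
    and up: "\<forall>i<k. u i \<in> U \<and> p i \<in> V"
    and dual: "\<forall>i<k. \<forall>j<k. B (u i) (p j) = of_bool (i = j)"
  obtains (dual_pair) x v where "x \<in> U" "v \<in> V" "\<And>i. i < k \<Longrightarrow> B x (p i) = 0" "B x v = 1"
proof (rule ccontr)
  assume "\<not> thesis"
  have perp: "B x v = 0" if "x \<in> U" "v \<in> V" "\<And>i. i < k \<Longrightarrow> B x (p i) = 0" for x v
  proof (rule ccontr)
    assume "B x v \<noteq> 0"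
    then have "B x v = 1" by simp
    with that have thesis by (intro dual_pair[of x v])
    with \<open>\<not> thesis\<close> show False by contradiction
  qed
  obtain a b where ab: "{c \<in> V. \<forall>u\<in>U. B u c = 0} \<subseteq> F2.span (U \<union> {a, b})"
    using orthogonal_of_maximal[OF V(1) max] .
  have U: "totally_singular U" "U \<subseteq> V"
    using max by (simp_all add: maximal_totally_singular_def)
  have subU: "F2.subspace U" using U by (simp add: totally_singular_def)
  have "v \<in> F2.span (U \<union> {a, b} \<union> p ` {..<k})" if v: "v \<in> V" for v
  proof -
    \<comment> \<open>\<open>s\<close> is the component of \<open>v\<close> along the
      \<open>p i\<close>, and \<open>r\<close> below is that of \<open>x\<close> along the
      \<open>u i\<close>. Both \<open>B r v\<close> and \<open>B x s\<close> are the sum of the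
      products \<open>B x (p i) * B (u i) v\<close>, so
      \<open>B x (v + s) = B (x + r) v\<close>.\<close>
    define s where "s = (\<Sum>i<k. F2_scale (B (u i) v) (p i))"
    have sV: "s \<in> V" unfolding s_def using up
      by (intro F2.subspace_sum F2.subspace_scale V(1)) auto
    have "B x (v + s) = 0" if x: "x \<in> U" for x
    proof -
      define r where "r = (\<Sum>i<k. F2_scale (B x (p i)) (u i))"
      have rU: "r \<in> U" unfolding r_def using up
        by (intro F2.subspace_sum F2.subspace_scale subU) auto
      have "B (x + r) v = 0"
      proof (rule perp)
        show "x + r \<in> U" using x rU subU by (rule F2.subspace_add[rotated])
        fix j assume j: "j < k"
        have "B r (p j) = (\<Sum>i<k. B x (p i) * of_bool (i = j))"
          unfolding r_def polar_sum_left by (intro sum.cong refl) (simp add: dual j)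
        also have "\<dots> = B x (p j)"
          by (rule sum_mult_of_bool(2)[OF j])
        finally show "B (x + r) (p j) = 0" by (simp add: polar_add_left)
      qed (fact v)
      moreover have "B r v = B x s"
        unfolding r_def s_def polar_sum_left polar_sum_right by (simp add: mult.commute)
      ultimately show ?thesis by (simp add: polar_add_left polar_add_right)
    qed
    then have "v + s \<in> F2.span (U \<union> {a, b})"
      using ab v sV V(1) by (auto intro: F2.subspace_add)
    then have "v + s \<in> F2.span (U \<union> {a, b} \<union> p ` {..<k})"
      using F2.span_mono[of "U \<union> {a, b}" "U \<union> {a, b} \<union> p ` {..<k}"] by blast
    moreover have "s \<in> F2.span (U \<union> {a, b} \<union> p ` {..<k})"
      unfolding s_def by (intro F2.span_sum F2.span_scale F2.span_base) auto
    ultimately have "v + s + s \<in> F2.span (U \<union> {a, b} \<union> p ` {..<k})"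
      by (rule F2.span_add)
    then show ?thesis by (simp add: add.assoc)
  qed
  then have V_span: "V \<subseteq> F2.span (U \<union> {a, b} \<union> p ` {..<k})" by blast
  \<comment> \<open>Replacing \<open>U\<close> by a basis gives a spanning set small enough for the
    dimension count.\<close>
  obtain b' where b': "b' \<subseteq> U" "F2.independent b'" "U \<subseteq> F2.span b'" "card b' = F2.dim U"
    using F2.basis_exists .
  have "U \<union> {a, b} \<union> p ` {..<k} \<subseteq> F2.span (b' \<union> {a, b} \<union> p ` {..<k})"
    using b'(3) F2.span_mono[of b' "b' \<union> {a, b} \<union> p ` {..<k}"]
    by (auto intro: F2.span_base)
  then have "V \<subseteq> F2.span (b' \<union> {a, b} \<union> p ` {..<k})"
    by (intro subset_trans[OF V_span] F2.span_minimal F2.subspace_span)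
  moreover have "finite b'" using subset_trans[OF b'(1) U(2)] V(2) by (rule finite_subset)
  ultimately have "F2.dim V \<le> card (b' \<union> {a, b} \<union> p ` {..<k})"
    by (intro F2.dim_le_card) auto
  also have "\<dots> \<le> card b' + card {a, b} + card (p ` {..<k})"
    by (intro order_trans[OF card_Un_le] add_right_mono card_Un_le)
  also have "\<dots> \<le> F2.dim U + 2 + k"
    using b'(4) card_image_le[of "{..<k}" p] by (auto simp: card_insert_if)
  finally show False using dim by simp
qed

text \<open>The vectors \<open>p i\<close> carry a prescribed quadratic form; the dual vectors \<open>u i\<close> in the totally
  singular space serve to adjust its values and to keep the \<open>p i\<close> independent.\<close>

lemma prescribed_sequence:
  fixes s :: "nat \<Rightarrow> bit" and t :: "nat \<Rightarrow> nat \<Rightarrow> bit"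
  assumes V: "F2.subspace V" "finite V" and max: "maximal_totally_singular V U"
    and dim: "F2.dim U + m + 2 \<le> F2.dim V"
  shows "\<exists>u p. (\<forall>i<m. u i \<in> U \<and> p i \<in> V \<and> q (p i) = s i) \<and>
    (\<forall>i<m. \<forall>j<m. B (u i) (p j) = of_bool (i = j)) \<and> (\<forall>j<m. \<forall>i<j. B (p i) (p j) = t i j)"
  using dim
proof (induction m)
  case 0
  then show ?case by simp
next
  case (Suc m)
  then have "F2.dim U + m + 2 \<le> F2.dim V" by simp
  from Suc.IH[OF this] obtain u p
    where IH: "\<forall>i<m. u i \<in> U \<and> p i \<in> V \<and> q (p i) = s i"
      "\<forall>i<m. \<forall>j<m. B (u i) (p j) = of_bool (i = j)" "\<forall>j<m. \<forall>i<j. B (p i) (p j) = t i j"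
    by (elim exE conjE)
  then have up: "\<And>i. i < m \<Longrightarrow> u i \<in> U" "\<And>i. i < m \<Longrightarrow> p i \<in> V" "\<And>i. i < m \<Longrightarrow> q (p i) = s i"
    and dual: "\<And>i j. i < m \<Longrightarrow> j < m \<Longrightarrow> B (u i) (p j) = of_bool (i = j)"
    and t: "\<And>i j. j < m \<Longrightarrow> i < j \<Longrightarrow> B (p i) (p j) = t i j"
    by simp_all
  \<comment> \<open>The bound for \<open>Suc m\<close> is exactly the strict inequality that a
    further dual pair requires.\<close>
  have "F2.dim U + m + 2 < F2.dim V" using Suc.prems by simp
  moreover have "\<forall>i<m. u i \<in> U \<and> p i \<in> V" using up by simp
  ultimately obtain x v where
    x: "x \<in> U" and v: "v \<in> V" and xp: "\<And>i. i < m \<Longrightarrow> B x (p i) = 0" and xv: "B x v = 1"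
    using IH(2) by (rule dual_pair_extension[OF V max]) iprover
  have U: "totally_singular U" "U \<subseteq> V"
    using max by (simp_all add: maximal_totally_singular_def)
  have subU: "F2.subspace U" using U by (simp add: totally_singular_def)
  \<comment> \<open>This correction makes \<open>v\<close> orthogonal to every old
    \<open>u i\<close>; the pairing with \<open>x\<close> stays 1 because \<open>x\<close> is
    orthogonal to the \<open>p i\<close>.\<close>
  define v' where "v' = v + (\<Sum>i<m. F2_scale (B (u i) v) (p i))"
  have v'V: "v' \<in> V" unfolding v'_def using up v
    by (intro F2.subspace_add F2.subspace_sum F2.subspace_scale V(1)) auto
  have uv': "B (u i) v' = 0" if "i < m" for i
  proof -
    have "(\<Sum>j<m. B (u j) v * B (u i) (p j)) = (\<Sum>j<m. B (u j) v * of_bool (i = j))"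
      by (intro sum.cong refl) (simp add: dual that)
    also have "\<dots> = B (u i) v"
      by (rule sum_mult_of_bool(1)[OF that])
    finally show ?thesis
      by (simp add: v'_def polar_add_right polar_sum_right)
  qed
  have xv': "B x v' = 1"
    unfolding v'_def polar_add_right polar_sum_right using xv xp by simp
  \<comment> \<open>By duality, adding \<open>r\<close> to \<open>v'\<close> changes its pairing
    with \<open>p i\<close> to \<open>t i m\<close>.\<close>
  define r where "r = (\<Sum>i<m. F2_scale (B (p i) v' + t i m) (u i))"
  have rU: "r \<in> U" unfolding r_def using up
    by (intro F2.subspace_sum F2.subspace_scale subU) auto
  \<comment> \<open>Adding \<open>x\<close> flips the value of \<open>q\<close>, since
    \<open>q x = 0\<close> and \<open>B (v' + r) x = 1\<close>, and leaves the pairings with the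
    \<open>p i\<close> alone. So \<open>x\<close> is added exactly when the value is wrong.\<close>
  define y where "y = r + F2_scale (q (v' + r) + s m) x"
  define w where "w = v' + y"
  have yU: "y \<in> U" unfolding y_def using rU x
    by (intro F2.subspace_add F2.subspace_scale subU)
  have wV: "w \<in> V" unfolding w_def using yU U v'V by (intro F2.subspace_add V(1)) auto
  \<comment> \<open>The adjustment \<open>y\<close> lies in \<open>U\<close>, where the polar form
    vanishes, so the duality relations survive.\<close>
  have Uw: "B z w = B z v'" if "z \<in> U" for z
    unfolding w_def polar_add_right using totally_singular_polar[OF U(1) that yU] by simp
  have pw: "B (p i) w = t i m" if i: "i < m" for i
  proof -
    have "B (p i) r = (\<Sum>j<m. (B (p j) v' + t j m) * of_bool (j = i))"
      unfolding r_def polar_sum_right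
      by (intro sum.cong refl) (simp add: polar_commute[of "p i"] dual i)
    also have "\<dots> = B (p i) v' + t i m"
      by (rule sum_mult_of_bool(2)[OF i])
    finally have "B (p i) r = B (p i) v' + t i m" .
    moreover have "B (p i) (F2_scale c x) = 0" for c
      using xp[OF i] by (cases c) (auto simp: polar_commute)
    ultimately show ?thesis unfolding w_def y_def polar_add_right by simp
  qed
  have qw: "q w = s m"
  proof -
    have "q x = 0" using U x by (simp add: totally_singular_def)
    moreover have "B (v' + r) x = 1"
      using xv' totally_singular_polar[OF U(1) rU x]
      by (simp add: polar_add_left polar_commute[of v'])
    ultimately have "q ((v' + r) + F2_scale c x) = q (v' + r) + c" for c
      by (cases c) (simp_all add: add[of _ x])
    then show ?thesis unfolding w_def y_def by (simp add: add.assoc)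
  qed
  show ?case
    by (rule exI[of _ "u(m := x)"], rule exI[of _ "p(m := w)"])
      (use up dual t x xp wV qw pw Uw uv' xv' in \<open>auto simp: less_Suc_eq\<close>)
qed

end

section \<open>Matroids in \<open>E3\<close> as quadratic forms\<close>

lemma of_nat_bit: "(of_nat n :: bit) = of_bool (odd n)"
  by (induction n) auto

lemma subspace_F2_space: "F2.subspace (F2_space n)"
  by (auto simp: F2.subspace_def F2_space_def F2_scale_def)

lemma finite_F2_space: "finite (F2_space n)"
proof (rule finite_subset)
  show "F2_space n \<subseteq> (\<lambda>A i. of_bool (i \<in> A)) ` Pow {..<n}"
  proof
    fix v assume v: "v \<in> F2_space n"
    have "v = (\<lambda>i. of_bool (i \<in> {i. v i = 1}))"
    proof
      fix i show "v i = of_bool (i \<in> {i. v i = 1})" by (cases "v i") simp_all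
    qed
    moreover have "{i. v i = 1} \<subseteq> {..<n}"
    proof
      fix i assume "i \<in> {i. v i = 1}"
      then show "i \<in> {..<n}" using v by (cases "i < n") (auto simp: F2_space_def)
    qed
    ultimately show "v \<in> (\<lambda>A i. of_bool (i \<in> A)) ` Pow {..<n}" by blast
  qed
qed simp

lemma F2_span_insert: "F2.span (insert a S) = F2.span S \<union> {v. v + a \<in> F2.span S}"
proof -
  have "(\<exists>k. P k) \<longleftrightarrow> P 0 \<or> P 1" for P :: "bit \<Rightarrow> bool"
    by (metis bit_not_one_iff)
  then show ?thesis
    by (auto simp: F2.span_insert F2_minus_eq_plus)
qed

text \<open>Moved to one side, the identity is the sum of \<open>h\<close> over the seven nonzero
  combinations of \<open>x\<close>, \<open>y\<close>, \<open>z\<close>. For independent vectors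
  these form a flat of dimension 3, which meets the elements evenly; for dependent ones the terms
  cancel because \<open>h 0 = 0\<close>.\<close>

lemma E3_polar_add:
  assumes M: "M \<in> E3" and "x \<in> F2_space (mdim M)" "y \<in> F2_space (mdim M)" "z \<in> F2_space (mdim M)"
  defines "h \<equiv> \<lambda>v. of_bool (v \<in> elements M)"
  shows "polar h (x + y) z = polar h x z + polar h y z"
proof -
  have h0: "h 0 = 0"
    using M by (auto simp: h_def E3_def simple_binary_matroid_def ground_def geometry_def)
  show ?thesis
  \<comment> \<open>The seven alternatives are the possible linear dependencies: some nonempty
    subset of the three vectors sums to zero.\<close>
  proof (cases "x = 0 \<or> y = 0 \<or> z = 0 \<or> x = y \<or> x = z \<or> y = z \<or> z = x + y")
    case True
    then show ?thesis
      using h0 by (elim disjE) (simp_all add: polar_def ac_simps)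
  next
    case False
    have span1: "F2.span {z} = {0, z}"
      by (auto simp: F2_span_insert F2_add_eq_iff)
    have span2: "F2.span {y, z} = {0, z, y, y + z}"
      unfolding F2_span_insert[of y] span1 by (auto simp: F2_add_eq_iff)
    have "F2.span {x, y, z} = {0, x, y, z, x + y, x + z, y + z, x + y + z}"
      unfolding F2_span_insert[of x] span2 by (auto simp: F2_add_eq_iff ac_simps)
    moreover have distinct: "distinct [0, x, y, z, x + y, x + z, y + z, x + y + z]"
      using False by (auto simp: F2_add_eq_iff ac_simps)
    ultimately have span3: "F2.span {x, y, z} - {0} = {x, y, z, x + y, x + z, y + z, x + y + z}"
      by auto
    have "F2.independent {x, y, z}"
      using distinct by (simp add: F2.independent_insert span1 span2 F2.independent_empty)
    then have "F2.dim (F2.span {x, y, z}) = 3"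
      using False by (simp add: F2.dim_eq_card_independent)
    moreover have "F2.span {x, y, z} \<subseteq> F2_space (mdim M)"
      using assms by (intro F2.span_minimal subspace_F2_space) auto
    ultimately have "is_flat (mdim M) 3 {x, y, z, x + y, x + z, y + z, x + y + z}"
      unfolding is_flat_def span3[symmetric] using F2.subspace_span by blast
    then have "even (card (elements M \<inter> {x, y, z, x + y, x + z, y + z, x + y + z}))"
      using M by (auto simp: E3_def)
    \<comment> \<open>Casting the cardinality to \<open>bit\<close> turns evenness into a vanishing
      sum of \<open>h\<close>.\<close>
    then have "0 = (of_nat (card (elements M \<inter> {x, y, z, x + y, x + z, y + z, x + y + z})) :: bit)"
      by (simp add: of_nat_bit)
    also have "\<dots> = (\<Sum>v\<in>{x, y, z, x + y, x + z, y + z, x + y + z}. h v)"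
      unfolding h_def by (simp add: sum_of_bool_eq Int_commute Int_def)
    also have "\<dots> = h x + h y + h z + h (x + y) + h (x + z) + h (y + z) + h (x + y + z)"
      using distinct by (simp add: add.assoc)
    finally have parity: "0 = h x + h y + h z + h (x + y) + h (x + z) + h (y + z) + h (x + y + z)" .
    have "0 = a + b + c + d + e + f + g \<Longrightarrow> g + d + c = (e + a + c) + (f + b + c)"
      for a b c d e f g :: bit
      by (cases a; cases b; cases c; cases d; cases e; cases f; cases g) simp_all
    from this[OF parity] show ?thesis unfolding polar_def .
  qed
qed

definition truncate :: "nat \<Rightarrow> (nat \<Rightarrow> bit) \<Rightarrow> nat \<Rightarrow> bit" where
  "truncate n v = (\<lambda>i. if i < n then v i else 0)"

text \<open>The form is extended to all vectors by truncation, so that its algebra needs no carrier.\<close>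

definition matroid_form :: "matroid \<Rightarrow> (nat \<Rightarrow> bit) \<Rightarrow> bit" where
  "matroid_form M v = of_bool (truncate (mdim M) v \<in> elements M)"

lemma truncate_in: "truncate n v \<in> F2_space n"
  by (simp add: truncate_def F2_space_def)

lemma truncate_id: "v \<in> F2_space n \<Longrightarrow> truncate n v = v"
  by (auto simp: truncate_def F2_space_def fun_eq_iff)

lemma truncate_add: "truncate n (v + w) = truncate n v + truncate n w"
  by (auto simp: truncate_def fun_eq_iff)

lemma matroid_form_eq: "v \<in> F2_space (mdim M) \<Longrightarrow> matroid_form M v = of_bool (v \<in> elements M)"
  by (simp add: matroid_form_def truncate_id)

lemma quadratic_form_E3:
  assumes "M \<in> E3"
  shows "quadratic_form (matroid_form M)"
proof
  show "matroid_form M 0 = 0"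
    using assms by (subst matroid_form_eq)
      (auto simp: F2_space_def E3_def simple_binary_matroid_def ground_def geometry_def)
  fix x y z
  show "polar (matroid_form M) (x + y) z = polar (matroid_form M) x z + polar (matroid_form M) y z"
    using E3_polar_add[OF assms truncate_in[of _ x] truncate_in[of _ y] truncate_in[of _ z]]
    by (simp only: polar_def matroid_form_def truncate_add)
qed

text \<open>The nonzero vectors of \<open>U\<close> form a flat that avoids the elements, so the
  codimension of \<open>U\<close> competes in the minimum defining the critical number.\<close>

lemma critical_number_le:
  assumes "M \<in> E3" "quadratic_form.totally_singular (matroid_form M) U" "U \<subseteq> F2_space (mdim M)"
  shows "F2.dim U + critical_number M \<le> mdim M"
proof -
  interpret g: quadratic_form "matroid_form M" by (rule quadratic_form_E3[OF assms(1)])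
  \<comment> \<open>This keeps the natural-number subtraction \<open>mdim M - F2.dim U\<close> from
    truncating.\<close>
  have le: "F2.dim U \<le> mdim M"
  proof -
    obtain c where c: "c \<subseteq> F2_space (mdim M)" "F2.independent c"
      "F2_space (mdim M) \<subseteq> F2.span c" "card c = F2.dim (F2_space (mdim M))"
      using F2.basis_exists .
    have "finite c" using c(1) finite_F2_space by (rule finite_subset)
    then have "F2.dim U \<le> card c"
      using c(3) assms(3) by (intro F2.dim_le_card) auto
    then show ?thesis using c(4) by (simp add: dim_F2_space)
  qed
  have "critical_number M \<le> mdim M - F2.dim U"
    unfolding critical_number_def
  proof (rule Least_le, intro exI conjI)
    show "is_flat (mdim M) (F2.dim U) (U - {0})"
      using assms by (auto simp: is_flat_def g.totally_singular_def)
    show "U - {0} \<subseteq> ground M - elements M"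
    proof
      fix v assume v: "v \<in> U - {0}"
      then have "matroid_form M v = 0" using assms(2) by (simp add: g.totally_singular_def)
      then show "v \<in> ground M - elements M"
        using v assms(3) matroid_form_eq[of v M] by (auto simp: ground_def geometry_def split: if_splits)
    qed
  qed (use le in simp)
  then show ?thesis using le by simp
qed

section \<open>Isometric embeddings\<close>

lemma F2_space_Suc_cases:
  assumes "v \<in> F2_space (Suc k)"
  obtains "v \<in> F2_space k" | w where "w \<in> F2_space k" "v = w + (\<lambda>i. of_bool (i = k))"
proof (cases "v k = 0")
  case True
  have "v i = 0" if "i \<ge> k" for i
    using that True assms by (cases "i = k") (simp_all add: F2_space_def)
  then have "v \<in> F2_space k" by (simp add: F2_space_def)
  then show ?thesis by (rule that(1))
next
  case False
  then have "v + (\<lambda>i. of_bool (i = k)) \<in> F2_space k"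
    using assms by (auto simp: F2_space_def)
  moreover have "v = (v + (\<lambda>i. of_bool (i = k))) + (\<lambda>i. of_bool (i = k))"
    by (simp add: add.assoc)
  ultimately show ?thesis by (rule that(2))
qed

text \<open>A quadratic form is determined by its values on a basis and its polar form on pairs of
  basis vectors.\<close>

lemma linear_combination_form:
  fixes p :: "nat \<Rightarrow> nat \<Rightarrow> bit"
  defines "e \<equiv> \<lambda>k i. of_bool (i = k)" and "\<phi> \<equiv> \<lambda>k v. \<Sum>i<k. F2_scale (v i) (p i)"
  assumes "quadratic_form f" "quadratic_form g"
    and diag: "\<And>i. i < m \<Longrightarrow> g (p i) = f (e i)"
    and off: "\<And>i j. j < m \<Longrightarrow> i < j \<Longrightarrow> polar g (p i) (p j) = polar f (e i) (e j)"
  shows "k \<le> m \<Longrightarrow> v \<in> F2_space k \<Longrightarrow> g (\<phi> k v) = f v"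
proof -
  interpret f: quadratic_form f by fact
  interpret g: quadratic_form g by fact
  have \<phi>_Suc: "\<phi> (Suc k) v = \<phi> k v + F2_scale (v k) (p k)" for k v
    unfolding \<phi>_def by (rule sum.lessThan_Suc)
  have \<phi>_e: "\<phi> k (v + e l) = \<phi> k v" if "k \<le> l" for k l v
    unfolding \<phi>_def by (intro sum.cong refl) (use that in \<open>auto simp: e_def\<close>)
  have pol: "polar g (\<phi> k v) (p j) = polar f v (e j)" if "k \<le> j" "j < m" "v \<in> F2_space k" for k v j
    using that
  proof (induction k arbitrary: v)
    case 0
    then have "v = 0" by (auto simp: F2_space_def fun_eq_iff)
    then show ?case by (simp only: \<phi>_def lessThan_0 sum.empty g.polar_zero_left f.polar_zero_left)
  next
    case (Suc k)
    from Suc.prems(3) show ?case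
    proof (cases rule: F2_space_Suc_cases)
      case 1
      then have "v k = 0" by (simp add: F2_space_def)
      then show ?thesis using Suc 1 by (simp add: \<phi>_Suc)
    next
      case (2 w)
      have vk: "v k = 1" using 2 by (simp add: F2_space_def)
      have v: "v = w + e k" using 2 by (simp add: e_def)
      have "\<phi> (Suc k) v = \<phi> k w + p k" unfolding \<phi>_Suc vk unfolding v \<phi>_e[OF le_refl] by simp
      moreover have "polar g (\<phi> k w) (p j) = polar f w (e j)" using Suc 2 by simp
      moreover have "polar g (p k) (p j) = polar f (e k) (e j)" using Suc.prems off by simp
      ultimately show ?thesis unfolding v by (simp only: g.polar_add_left f.polar_add_left)
    qed
  qed
  show "k \<le> m \<Longrightarrow> v \<in> F2_space k \<Longrightarrow> g (\<phi> k v) = f v"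
  proof (induction k arbitrary: v)
    case 0
    then have "v = 0" by (auto simp: F2_space_def fun_eq_iff)
    then show ?case by (simp only: \<phi>_def lessThan_0 sum.empty g.zero f.zero)
  next
    case (Suc k)
    from Suc.prems(2) show ?case
    proof (cases rule: F2_space_Suc_cases)
      case 1
      then have "v k = 0" by (simp add: F2_space_def)
      then show ?thesis using Suc 1 by (simp add: \<phi>_Suc)
    next
      case (2 w)
      have vk: "v k = 1" using 2 by (simp add: F2_space_def)
      have v: "v = w + e k" using 2 by (simp add: e_def)
      have "\<phi> (Suc k) v = \<phi> k w + p k" unfolding \<phi>_Suc vk unfolding v \<phi>_e[OF le_refl] by simp
      moreover have "polar g (\<phi> k w) (p k) = polar f w (e k)" using Suc.prems 2 pol by simp
      moreover have "g (\<phi> k w) = f w" using Suc 2 by simp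
      moreover have "g (p k) = f (e k)" using Suc.prems diag by simp
      ultimately show ?thesis unfolding v by (simp only: g.add f.add)
    qed
  qed
qed

theorem theorem4p7:
  fixes M N :: matroid
  assumes "M \<in> E3" and "N \<in> E3"
    and "critical_number M \<ge> mdim N + 4"
  shows "contains_induced_restriction M N"
proof -
  let ?V = "F2_space (mdim M)" and ?m = "mdim N"
  let ?f = "matroid_form N" and ?g = "matroid_form M"
  let ?e = "\<lambda>k i. of_bool (i = k) :: bit"
  interpret f: quadratic_form ?f by (rule quadratic_form_E3[OF assms(2)])
  interpret g: quadratic_form ?g by (rule quadratic_form_E3[OF assms(1)])
  obtain U where max: "g.maximal_totally_singular ?V U"
    using g.maximal_totally_singular_exists[OF subspace_F2_space finite_F2_space] .
  then have U: "g.totally_singular U" "U \<subseteq> ?V"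
    by (simp_all add: g.maximal_totally_singular_def)
  \<comment> \<open>The codimension of \<open>U\<close> is at least the critical number, which
    leaves room for \<open>?m\<close> dual pairs beside the at most two anisotropic
    dimensions.\<close>
  have "F2.dim U + ?m + 2 \<le> F2.dim ?V"
    using critical_number_le[OF assms(1) U] assms(3) by (simp add: dim_F2_space)
  \<comment> \<open>The prescribed data are those of the form of \<open>N\<close> on the standard
    basis.\<close>
  from g.prescribed_sequence[OF subspace_F2_space finite_F2_space max this,
      of "\<lambda>i. ?f (?e i)" "\<lambda>i j. polar ?f (?e i) (?e j)"]
  obtain u p where up: "\<forall>i<?m. u i \<in> U \<and> p i \<in> ?V \<and> ?g (p i) = ?f (?e i)"
    and dual: "\<forall>i<?m. \<forall>j<?m. polar ?g (u i) (p j) = of_bool (i = j)"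
    and off: "\<forall>j<?m. \<forall>i<j. polar ?g (p i) (p j) = polar ?f (?e i) (?e j)"
    by (elim exE conjE)
  define \<phi> where "\<phi> v = (\<Sum>i<?m. F2_scale (v i) (p i))" for v
  have form: "?g (\<phi> v) = ?f v" if "v \<in> F2_space ?m" for v
    unfolding \<phi>_def using linear_combination_form[OF f.quadratic_form_axioms g.quadratic_form_axioms,
        of ?m p ?m v] up off that by simp
  have \<phi>V: "\<phi> v \<in> ?V" for v
    unfolding \<phi>_def using up by (intro F2.subspace_sum F2.subspace_scale subspace_F2_space) auto
  \<comment> \<open>Pairing with \<open>u j\<close> reads off the coordinate \<open>j\<close>, so
    \<open>\<phi>\<close> is injective.\<close>
  have coord: "polar ?g (u j) (\<phi> v) = v j" if "j < ?m" for j v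
  proof -
    have "polar ?g (u j) (\<phi> v) = (\<Sum>i<?m. v i * of_bool (j = i))"
      unfolding \<phi>_def g.polar_sum_right by (intro sum.cong refl) (simp add: dual that)
    also have "\<dots> = v j"
      by (rule sum_mult_of_bool(1)[OF that])
    finally show ?thesis .
  qed
  have inj: "inj_on \<phi> (F2_space ?m)"
  proof (rule inj_onI, rule ext)
    fix v w i assume "v \<in> F2_space ?m" "w \<in> F2_space ?m" "\<phi> v = \<phi> w"
    then show "v i = w i"
      using coord[of i v] coord[of i w] by (cases "i < ?m") (auto simp: F2_space_def)
  qed
  have lin: "F2_linear_on ?m \<phi>"
    unfolding F2_linear_on_def \<phi>_def
    by (auto simp only: plus_fun_apply F2.scale_left_distrib sum.distrib F2.scale_sum_right
        F2.scale_scale F2_scale_apply)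
  have "\<phi> ` elements N = elements M \<inter> \<phi> ` ground N"
  proof -
    \<comment> \<open>Both forms are indicator functions, so preserving the form preserves
      membership in both directions, which makes the restriction induced.\<close>
    have mem: "\<phi> v \<in> elements M \<longleftrightarrow> v \<in> elements N" if "v \<in> F2_space ?m" for v
      using form[OF that] matroid_form_eq[OF that] matroid_form_eq[OF \<phi>V, of v]
      by (simp add: of_bool_eq_iff)
    moreover have "elements N \<subseteq> ground N" "ground N \<subseteq> F2_space ?m"
      using assms(2) by (auto simp: E3_def simple_binary_matroid_def ground_def geometry_def)
    ultimately show ?thesis by blast
  qed
  then show ?thesis
    unfolding contains_induced_restriction_def using lin inj \<phi>V by blast
qed

end
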